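(* Let a sign pattern be given by a signed digraph on nodes $\{1,\dots,n\}$ with sign pattern matrix $\mathcal{A}$ (entries in $\{+,-,0\}$, entry $(j,l)$ nonzero meaning a directed edge $l\to j$ of the indicated sign) and input $B=b_1e_1$, $b_1>0$, such that node $1$ (the leader) has no incoming edges from the other nodes and every node is reachable from node $1$ by a directed walk. Consider temporally switching systems $\dot{x}(t)=A_ix(t)+Bu(t)$, $t\in[t_{i-1},t_i)$, in which every snapshot matrix $A_i$ has exactly the sign pattern $\mathcal{A}$ (same topology and same signs, only the magnitudes of the edge weights may differ between snapshots). Then there exist two realizations $A_1,A_2$ with sign pattern $\mathcal{A}$ and times $t_0<t_1<t_2$ such that the two-snapshot temporally switching system is completely herdable on $[t_0,t_2]$; that is, the temporal network with fixed topology is $\mathcal{SS}$ herdable within two snapshots (even when the static digraph is not $\mathcal{SS}$ herdable, e.g. because of signed or layer dilations).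
   Context: Completely herdable on $[t_0,t_f]$: for every initial condition $x(t_0)\in\mathbb{R}^n$ and every $h>0$ there is a piecewise continuous input $u$ on $[t_0,t_f]$ such that $x_j(t_f)\ge h$ for all $j=1,\dots,n$. A temporally switching digraph with a fixed sign pattern in all snapshots is $\mathcal{SS}$ herdable if there is a realization $(A_i,B)$ of the snapshots consistent with the sign pattern for which the temporal network is completely herdable. A signed dilation is a node whose outgoing edges have different signs; a layer dilation occurs in layer $L_k$ of the signed layered graph (layer $L_{k+1}$ = nodes reachable from the leader by a walk of length $k$) if the edges from nodes of $L_k$ to nodes of $L_{k+1}$ have mixed signs. *)

theory Defs
  imports "HOL-Analysis.Analysis"
begin

text \<open>Signs of a sign pattern matrix.\<close>
datatype sign = Plus | Minus | Zero

text \<open>Entry (j,k) of the sign pattern (and of a realization) concerns the edge k -> j.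
  A real matrix is a realization of the sign pattern S if it has exactly that sign pattern.\<close>
definition has_sign_pattern :: "('n::finite \<Rightarrow> 'n \<Rightarrow> sign) \<Rightarrow> real^'n^'n \<Rightarrow> bool" where
  "has_sign_pattern S A \<longleftrightarrow>
     (\<forall>j k. (S j k = Plus \<longrightarrow> A $ j $ k > 0) \<and>
            (S j k = Minus \<longrightarrow> A $ j $ k < 0) \<and>
            (S j k = Zero \<longrightarrow> A $ j $ k = 0))"

text \<open>Directed edge k -> j of the signed digraph.\<close>
definition edge :: "('n \<Rightarrow> 'n \<Rightarrow> sign) \<Rightarrow> 'n \<Rightarrow> 'n \<Rightarrow> bool" where
  "edge S k j \<longleftrightarrow> S j k \<noteq> Zero"

text \<open>Piecewise continuous scalar input on [a,b]: continuous except at finitely many points,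
  where one-sided limits (within the interval) exist.\<close>
definition piecewise_continuous_on :: "real \<Rightarrow> real \<Rightarrow> (real \<Rightarrow> real) \<Rightarrow> bool" where
  "piecewise_continuous_on a b u \<longleftrightarrow>
     (\<exists>D. finite D \<and> continuous_on ({a..b} - D) u \<and>
        (\<forall>s\<in>D. (\<exists>L. (u \<longlongrightarrow> L) (at s within {a..<s})) \<and>
                (\<exists>R. (u \<longlongrightarrow> R) (at s within {s<..b}))))"

text \<open>x solves  x'(t) = A(t) x(t) + B u(t)  on [t0,tf] (continuous, ODE holds off a finite set).\<close>
definition solves_lti :: "(real \<Rightarrow> real^'n^'n) \<Rightarrow> real^'n \<Rightarrow> real \<Rightarrow> real \<Rightarrow>
    (real \<Rightarrow> real) \<Rightarrow> (real \<Rightarrow> real^'n) \<Rightarrow> bool" where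
  "solves_lti A B t0 tf u x \<longleftrightarrow>
     continuous_on {t0..tf} x \<and>
     (\<exists>F. finite F \<and> (\<forall>t\<in>{t0<..<tf} - F.
        (x has_vector_derivative (A t *v x t + u t *\<^sub>R B)) (at t)))"

definition completely_herdable :: "(real \<Rightarrow> real^'n::finite^'n) \<Rightarrow> real^'n \<Rightarrow> real \<Rightarrow> real \<Rightarrow> bool" where
  "completely_herdable A B t0 tf \<longleftrightarrow>
     (\<forall>x0 h. h > 0 \<longrightarrow>
        (\<exists>u x. piecewise_continuous_on t0 tf u \<and> solves_lti A B t0 tf u x \<and> x t0 = x0 \<and>
               (\<forall>j. x tf $ j \<ge> h)))"

text \<open>Two-snapshot temporal system: A1 on [t0,t1), A2 on [t1,t2].\<close>
definition two_snapshots :: "real^'n^'n \<Rightarrow> real^'n^'n \<Rightarrow> real \<Rightarrow> real \<Rightarrow> real^'n^'n" where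
  "two_snapshots A1 A2 t1 t = (if t < t1 then A1 else A2)"

end

theory Submission
  imports Defs
begin

text \<open>
  Choose a realization \<open>A\<^sub>1\<close> of the sign pattern whose Krylov space
  \<open>K\<^sub>1 = span {A\<^sub>1\<^sup>k B}\<close> contains a vector \<open>v\<close> without zero entries: give weight \<open>1\<close> to the
  edges of a shortest-path tree rooted at the leader and a small weight \<open>\<epsilon>\<close> to all other
  edges. Conjugating by the positive diagonal matrix \<open>D\<close> with \<open>D\<^sub>j\<^sub>j = 2\<close> if \<open>v\<^sub>j > 0\<close> and
  \<open>1/2\<close> otherwise gives a second realization \<open>A\<^sub>2 = D A\<^sub>1 D\<^sup>-\<^sup>1\<close> with Krylov space
  \<open>D K\<^sub>1 \<ni> D v\<close>, and \<open>D v - v\<close> is positive. Steer \<open>0\<close> to \<open>-v\<close> in the first snapshot;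
  in a second snapshot of small length \<open>\<tau>\<close> the drift barely moves \<open>-v\<close> while the input
  adds \<open>D v\<close>, so \<open>exp(\<tau> A\<^sub>2) (-v) + D v \<approx> D v - v\<close>, a positive vector, is reachable from
  \<open>0\<close>. By linearity, the free motion from any
  initial state plus a large multiple of that vector exceeds any threshold.
\<close>

section \<open>Flows of linear and affine systems\<close>

text \<open>Bounded linear endomorphisms form a Banach algebra, so the exponential series yields the
  flow of a linear differential equation.\<close>

typedef (overloaded) ('a::real_normed_vector) endo = "UNIV :: ('a \<Rightarrow>\<^sub>L 'a) set"
  morphisms blinfun_of_endo endo_of_blinfun ..

setup_lifting type_definition_endo

instantiation endo :: (real_normed_vector) real_normed_vector
begin
lift_definition norm_endo :: "'a endo \<Rightarrow> real" is norm .
lift_definition minus_endo :: "'a endo \<Rightarrow> 'a endo \<Rightarrow> 'a endo" is "(-)" .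
lift_definition plus_endo :: "'a endo \<Rightarrow> 'a endo \<Rightarrow> 'a endo" is "(+)" .
lift_definition uminus_endo :: "'a endo \<Rightarrow> 'a endo" is "uminus" .
lift_definition zero_endo :: "'a endo" is "0" .
lift_definition scaleR_endo :: "real \<Rightarrow> 'a endo \<Rightarrow> 'a endo" is "scaleR" .
definition dist_endo :: "'a endo \<Rightarrow> 'a endo \<Rightarrow> real" where "dist_endo a b = norm (a - b)"
definition sgn_endo :: "'a endo \<Rightarrow> 'a endo" where "sgn_endo x = scaleR (inverse (norm x)) x"
definition uniformity_endo :: "('a endo \<times> 'a endo) filter" where
  "uniformity_endo = (INF e\<in>{0 <..}. principal {(x, y). dist x y < e})"
definition open_endo :: "'a endo set \<Rightarrow> bool" where
  "open_endo S = (\<forall>x\<in>S. \<forall>\<^sub>F (x', y) in uniformity. x' = x \<longrightarrow> y \<in> S)"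
instance
  by standard (unfold dist_endo_def open_endo_def sgn_endo_def uniformity_endo_def,
      (rule refl | (transfer, force simp: norm_triangle_ineq algebra_simps))+)
end

instantiation endo :: (real_normed_vector) "{times, one}"
begin
lift_definition times_endo :: "'a endo \<Rightarrow> 'a endo \<Rightarrow> 'a endo" is blinfun_compose .
lift_definition one_endo :: "'a endo" is id_blinfun .
instance ..
end

lemma id_blinfun_neq_zero: "(id_blinfun :: 'a::euclidean_space \<Rightarrow>\<^sub>L 'a) \<noteq> 0"
  by (metis blinfun_apply_id_blinfun nonempty_Basis nonzero_Basis ex_in_conv zero_blinfun.rep_eq)

instance endo :: (euclidean_space) real_normed_algebra_1
  by standard (transfer; auto intro!: blinfun_eqI simp: blinfun.bilinear_simps
      norm_blinfun_compose id_blinfun_neq_zero[symmetric])+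

instance endo :: (euclidean_space) banach
proof
  fix X :: "nat \<Rightarrow> 'a endo"
  assume "Cauchy X"
  then have "Cauchy (\<lambda>n. blinfun_of_endo (X n))"
    unfolding Cauchy_def dist_norm dist_endo_def by transfer
  then obtain L where "(\<lambda>n. blinfun_of_endo (X n)) \<longlonglongrightarrow> L"
    using Cauchy_convergent_iff convergent_def by blast
  then have "X \<longlonglongrightarrow> endo_of_blinfun L"
    unfolding LIMSEQ_def dist_norm dist_endo_def
    by (simp add: minus_endo.rep_eq norm_endo.rep_eq endo_of_blinfun_inverse)
  then show "convergent X" by (auto simp: convergent_def)
qed

definition linear_flow :: "('a::euclidean_space \<Rightarrow> 'a) \<Rightarrow> real \<Rightarrow> 'a \<Rightarrow> 'a" where
  "linear_flow f t = blinfun_of_endo (exp (t *\<^sub>R endo_of_blinfun (Blinfun f)))"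

lemma linear_flow_0 [simp]: "linear_flow f 0 x = x"
  by (simp add: linear_flow_def one_endo.rep_eq)

lemma has_vector_derivative_linear_flow:
  assumes "bounded_linear f"
  shows "((\<lambda>t. linear_flow f t x) has_vector_derivative f (linear_flow f t x)) (at t)"
proof -
  let ?F = "endo_of_blinfun (Blinfun f)"
  have apply_at_x: "bounded_linear (\<lambda>E. blinfun_apply (blinfun_of_endo E) x)"
    by (rule bounded_linear_intro[where K = "norm x"])
      (auto simp: plus_endo.rep_eq scaleR_endo.rep_eq norm_endo.rep_eq blinfun.add_left
        blinfun.scaleR_left norm_blinfun)
  have "((\<lambda>t. exp (t *\<^sub>R ?F)) has_vector_derivative ?F * exp (t *\<^sub>R ?F)) (at t)"
    by (rule exp_scaleR_has_vector_derivative_left)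
  from bounded_linear.has_vector_derivative[OF apply_at_x this] show ?thesis
    using assms by (simp add: linear_flow_def times_endo.rep_eq endo_of_blinfun_inverse
        bounded_linear_Blinfun_apply)
qed

text \<open>\<open>x' = f x + b\<close> is solved through the linear system \<open>(x, c)' = (f x + c b, 0)\<close>,
  started with \<open>c = 1\<close>.\<close>
definition affine_flow :: "('a::euclidean_space \<Rightarrow> 'a) \<Rightarrow> 'a \<Rightarrow> 'a \<Rightarrow> real \<Rightarrow> 'a" where
  "affine_flow f b x t = fst (linear_flow (\<lambda>(y, c). (f y + c *\<^sub>R b, 0 :: real)) t (x, 1))"

lemma affine_flow_0 [simp]: "affine_flow f b x 0 = x"
  by (simp add: affine_flow_def)

lemma has_vector_derivative_affine_flow:
  assumes "bounded_linear f"
  shows "(affine_flow f b x has_vector_derivative f (affine_flow f b x t) + b) (at t)"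
proof -
  let ?g = "\<lambda>(y, c). (f y + c *\<^sub>R b, 0 :: real)"
  let ?z = "\<lambda>t. linear_flow ?g t (x, 1)"
  have "bounded_linear ?g"
    unfolding case_prod_unfold
    by (intro bounded_linear_Pair bounded_linear_add bounded_linear_compose[OF assms]
        bounded_linear_fst bounded_linear_zero
        bounded_linear_compose[OF bounded_linear_scaleR_left bounded_linear_snd])
  then have z': "(?z has_vector_derivative ?g (?z t)) (at t)" for t
    by (rule has_vector_derivative_linear_flow)
  have "\<forall>t. ((\<lambda>t. snd (?z t)) has_real_derivative 0) (at t)"
    using bounded_linear.has_vector_derivative[OF bounded_linear_snd z']
    by (simp add: case_prod_unfold has_real_derivative_iff_has_vector_derivative)
  then have "snd (?z t) = snd (?z 0)" for t
    by (rule DERIV_isconst_all)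
  then have "snd (?z t) = 1" for t
    by simp
  then show ?thesis
    using bounded_linear.has_vector_derivative[OF bounded_linear_fst z']
    by (simp add: affine_flow_def[abs_def] case_prod_unfold)
qed

section \<open>Solutions and piecewise continuous inputs\<close>

lemma solves_lti_everywhere:
  assumes "\<And>t. (x has_vector_derivative A t *v x t + u t *\<^sub>R B) (at t)"
  shows "solves_lti A B a b u x"
  unfolding solves_lti_def
proof
  show "continuous_on {a..b} x"
    using assms by (meson continuous_at_imp_continuous_on has_vector_derivative_continuous)
qed (use assms in \<open>intro exI[of _ "{}"], auto\<close>)

lemma solves_lti_cong:
  assumes "solves_lti A B a b u x"
    and "\<And>t. t \<in> {a..b} \<Longrightarrow> x t = x' t"
    and "\<And>t. t \<in> {a<..<b} \<Longrightarrow> u t = u' t"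
    and "\<And>t. t \<in> {a<..<b} \<Longrightarrow> A t = A' t"
  shows "solves_lti A' B a b u' x'"
proof -
  from assms(1) obtain F where cont: "continuous_on {a..b} x" and "finite F"
    and D: "\<And>t. t \<in> {a<..<b} - F \<Longrightarrow> (x has_vector_derivative A t *v x t + u t *\<^sub>R B) (at t)"
    unfolding solves_lti_def by blast
  have "continuous_on {a..b} x'"
    using cont assms(2) continuous_on_cong by blast
  moreover have "(x' has_vector_derivative A' t *v x' t + u' t *\<^sub>R B) (at t)"
    if t: "t \<in> {a<..<b} - F" for t
  proof -
    have "(x' has_vector_derivative A t *v x t + u t *\<^sub>R B) (at t)"
      by (rule has_vector_derivative_transform_within_open[OF D[OF t], of "{a<..<b}"])
        (use t assms(2) in auto)
    then show ?thesis
      using t assms(2-4) by simp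
  qed
  ultimately show ?thesis
    using \<open>finite F\<close> unfolding solves_lti_def by blast
qed

lemma solves_lti_append:
  assumes "a \<le> b" "b \<le> c" "solves_lti A B a b u x" "solves_lti A B b c u x"
  shows "solves_lti A B a c u x"
proof -
  from assms(3) obtain F1 where c1: "continuous_on {a..b} x" and "finite F1"
    and D1: "\<And>t. t \<in> {a<..<b} - F1 \<Longrightarrow> (x has_vector_derivative A t *v x t + u t *\<^sub>R B) (at t)"
    unfolding solves_lti_def by blast
  from assms(4) obtain F2 where c2: "continuous_on {b..c} x" and "finite F2"
    and D2: "\<And>t. t \<in> {b<..<c} - F2 \<Longrightarrow> (x has_vector_derivative A t *v x t + u t *\<^sub>R B) (at t)"
    unfolding solves_lti_def by blast
  have "{a..c} = {a..b} \<union> {b..c}"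
    using assms(1,2) by auto
  then have "continuous_on {a..c} x"
    using continuous_on_closed_Un[OF closed_atLeastAtMost closed_atLeastAtMost c1 c2] by simp
  moreover have "(x has_vector_derivative A t *v x t + u t *\<^sub>R B) (at t)"
    if "t \<in> {a<..<c} - (F1 \<union> F2 \<union> {b})" for t
    using that D1 D2 by (cases "t < b") auto
  ultimately show ?thesis
    using \<open>finite F1\<close> \<open>finite F2\<close> unfolding solves_lti_def
    by (intro conjI exI[of _ "F1 \<union> F2 \<union> {b}"]) auto
qed

lemma solves_lti_lincomb:
  assumes "solves_lti A B a b u x" "solves_lti A B a b v y"
  shows "solves_lti A B a b (\<lambda>t. u t + c * v t) (\<lambda>t. x t + c *\<^sub>R y t)"
proof -
  from assms(1) obtain F1 where c1: "continuous_on {a..b} x" and "finite F1"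
    and D1: "\<And>t. t \<in> {a<..<b} - F1 \<Longrightarrow> (x has_vector_derivative A t *v x t + u t *\<^sub>R B) (at t)"
    unfolding solves_lti_def by blast
  from assms(2) obtain F2 where c2: "continuous_on {a..b} y" and "finite F2"
    and D2: "\<And>t. t \<in> {a<..<b} - F2 \<Longrightarrow> (y has_vector_derivative A t *v y t + v t *\<^sub>R B) (at t)"
    unfolding solves_lti_def by blast
  have "continuous_on {a..b} (\<lambda>t. x t + c *\<^sub>R y t)"
    using c1 c2 by (intro continuous_intros)
  moreover have "((\<lambda>t. x t + c *\<^sub>R y t) has_vector_derivative
      A t *v (x t + c *\<^sub>R y t) + (u t + c * v t) *\<^sub>R B) (at t)"
    if "t \<in> {a<..<b} - (F1 \<union> F2)" for t
  proof -
    have "((\<lambda>t. x t + c *\<^sub>R y t) has_vector_derivative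
        (A t *v x t + u t *\<^sub>R B) + c *\<^sub>R (A t *v y t + v t *\<^sub>R B)) (at t)"
      using D1 D2 that by (auto intro!: derivative_eq_intros)
    then show ?thesis
      by (simp add: matrix_vector_right_distrib matrix_vector_mult_scaleR algebra_simps)
  qed
  ultimately show ?thesis
    using \<open>finite F1\<close> \<open>finite F2\<close> unfolding solves_lti_def
    by (intro conjI exI[of _ "F1 \<union> F2"]) auto
qed

lemma solves_lti_affine_flow:
  "solves_lti (\<lambda>_. M) B a b (\<lambda>_. c) (\<lambda>t. affine_flow ((*v) M) (c *\<^sub>R B) x0 (t - s))"
proof (rule solves_lti_everywhere)
  fix t
  have "(affine_flow ((*v) M) (c *\<^sub>R B) x0 \<circ> (\<lambda>t. t - s) has_vector_derivative
      1 *\<^sub>R (M *v affine_flow ((*v) M) (c *\<^sub>R B) x0 (t - s) + c *\<^sub>R B)) (at t)"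
    by (rule vector_diff_chain_at) (auto intro!: derivative_eq_intros
        has_vector_derivative_affine_flow matrix_vector_mul_bounded_linear)
  then show "((\<lambda>t. affine_flow ((*v) M) (c *\<^sub>R B) x0 (t - s)) has_vector_derivative
      M *v affine_flow ((*v) M) (c *\<^sub>R B) x0 (t - s) + c *\<^sub>R B) (at t)"
    by (simp add: o_def)
qed

text \<open>Unlike \<open>piecewise_continuous_on\<close>, this global notion is stable under gluing two
  inputs at a switching time.\<close>
definition piecewise_continuous :: "(real \<Rightarrow> real) \<Rightarrow> bool" where
  "piecewise_continuous u \<longleftrightarrow> (\<exists>D. finite D \<and> (\<forall>s. s \<notin> D \<longrightarrow> isCont u s) \<and>
     (\<forall>s. (\<exists>L. (u \<longlongrightarrow> L) (at_left s)) \<and> (\<exists>R. (u \<longlongrightarrow> R) (at_right s))))"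

lemma piecewise_continuous_imp_on:
  assumes "piecewise_continuous u"
  shows "piecewise_continuous_on a b u"
proof -
  obtain D where "finite D" and cont: "\<And>s. s \<notin> D \<Longrightarrow> isCont u s"
    and lim: "\<And>s. (\<exists>L. (u \<longlongrightarrow> L) (at_left s)) \<and> (\<exists>R. (u \<longlongrightarrow> R) (at_right s))"
    using assms unfolding piecewise_continuous_def by blast
  have "continuous_on ({a..b} - D) u"
    using cont by (intro continuous_at_imp_continuous_on) auto
  moreover have "\<exists>L. (u \<longlongrightarrow> L) (at s within {a..<s})" "\<exists>R. (u \<longlongrightarrow> R) (at s within {s<..b})" for s
  proof -
    obtain L R where "(u \<longlongrightarrow> L) (at_left s)" "(u \<longlongrightarrow> R) (at_right s)"
      using lim by blast
    then have "(u \<longlongrightarrow> L) (at s within {a..<s})" "(u \<longlongrightarrow> R) (at s within {s<..b})"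
      by (auto intro: tendsto_within_subset)
    then show "\<exists>L. (u \<longlongrightarrow> L) (at s within {a..<s})" "\<exists>R. (u \<longlongrightarrow> R) (at s within {s<..b})"
      by blast+
  qed
  ultimately show ?thesis
    using \<open>finite D\<close> unfolding piecewise_continuous_on_def by blast
qed

lemma piecewise_continuous_const: "piecewise_continuous (\<lambda>_. c)"
  unfolding piecewise_continuous_def by (intro exI[of _ "{}"]) auto

lemma piecewise_continuous_lincomb:
  assumes "piecewise_continuous u" "piecewise_continuous v"
  shows "piecewise_continuous (\<lambda>t. u t + c * v t)"
proof -
  obtain D where "finite D" and cu: "\<And>s. s \<notin> D \<Longrightarrow> isCont u s"
    and lu: "\<And>s. (\<exists>L. (u \<longlongrightarrow> L) (at_left s)) \<and> (\<exists>R. (u \<longlongrightarrow> R) (at_right s))"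
    using assms(1) unfolding piecewise_continuous_def by blast
  obtain E where "finite E" and cv: "\<And>s. s \<notin> E \<Longrightarrow> isCont v s"
    and lv: "\<And>s. (\<exists>L. (v \<longlongrightarrow> L) (at_left s)) \<and> (\<exists>R. (v \<longlongrightarrow> R) (at_right s))"
    using assms(2) unfolding piecewise_continuous_def by blast
  have "isCont (\<lambda>t. u t + c * v t) s" if "s \<notin> D \<union> E" for s
    using that cu cv by (auto intro: continuous_intros)
  moreover have "(\<exists>L. ((\<lambda>t. u t + c * v t) \<longlongrightarrow> L) (at_left s)) \<and>
      (\<exists>R. ((\<lambda>t. u t + c * v t) \<longlongrightarrow> R) (at_right s))" for s
    using lu[of s] lv[of s] by (metis tendsto_add tendsto_mult_left)
  ultimately show ?thesis
    using \<open>finite D\<close> \<open>finite E\<close> unfolding piecewise_continuous_def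
    by (intro exI[of _ "D \<union> E"]) auto
qed

lemma eventually_one_side:
  fixes r s :: real
  shows "(\<forall>\<^sub>F t in at_left s. t < r) \<or> (\<forall>\<^sub>F t in at_left s. r < t)"
    and "(\<forall>\<^sub>F t in at_right s. t < r) \<or> (\<forall>\<^sub>F t in at_right s. r < t)"
    and "s \<noteq> r \<Longrightarrow> (\<forall>\<^sub>F t in nhds s. t < r) \<or> (\<forall>\<^sub>F t in nhds s. r < t)"
proof -
  show "(\<forall>\<^sub>F t in at_left s. t < r) \<or> (\<forall>\<^sub>F t in at_left s. r < t)"
    using eventually_at_left_real[of r s]
    by (cases "s \<le> r") (auto simp: eventually_at_filter elim: eventually_mono)
  show "(\<forall>\<^sub>F t in at_right s. t < r) \<or> (\<forall>\<^sub>F t in at_right s. r < t)"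
    using eventually_at_right_real[of s r]
    by (cases "s < r") (auto simp: eventually_at_filter elim: eventually_mono)
  show "(\<forall>\<^sub>F t in nhds s. t < r) \<or> (\<forall>\<^sub>F t in nhds s. r < t)" if "s \<noteq> r"
    using that eventually_nhds_in_open[of "{..<r}" s] eventually_nhds_in_open[of "{r<..}" s]
    by (cases "s < r") auto
qed

lemma piecewise_continuous_if_le:
  assumes "piecewise_continuous u" "piecewise_continuous v"
  shows "piecewise_continuous (\<lambda>t. if t \<le> r then u t else v t)"
    (is "piecewise_continuous ?w")
proof -
  obtain D where "finite D" and cu: "\<And>s. s \<notin> D \<Longrightarrow> isCont u s"
    and lu: "\<And>s. (\<exists>L. (u \<longlongrightarrow> L) (at_left s)) \<and> (\<exists>R. (u \<longlongrightarrow> R) (at_right s))"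
    using assms(1) unfolding piecewise_continuous_def by blast
  obtain E where "finite E" and cv: "\<And>s. s \<notin> E \<Longrightarrow> isCont v s"
    and lv: "\<And>s. (\<exists>L. (v \<longlongrightarrow> L) (at_left s)) \<and> (\<exists>R. (v \<longlongrightarrow> R) (at_right s))"
    using assms(2) unfolding piecewise_continuous_def by blast
  have agree: "(\<forall>\<^sub>F t in F. ?w t = u t) \<or> (\<forall>\<^sub>F t in F. ?w t = v t)"
    if "(\<forall>\<^sub>F t in F. t < r) \<or> (\<forall>\<^sub>F t in F. r < t)" for F
  proof (rule disjE[OF that])
    assume "\<forall>\<^sub>F t in F. t < r"
    then have "\<forall>\<^sub>F t in F. ?w t = u t"
      by (rule eventually_mono) simp
    then show ?thesis ..
  next
    assume "\<forall>\<^sub>F t in F. r < t"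
    then have "\<forall>\<^sub>F t in F. ?w t = v t"
      by (rule eventually_mono) simp
    then show ?thesis ..
  qed
  have limit: "\<exists>L. (?w \<longlongrightarrow> L) F"
    if "(\<forall>\<^sub>F t in F. ?w t = u t) \<or> (\<forall>\<^sub>F t in F. ?w t = v t)"
      and "\<exists>L. (u \<longlongrightarrow> L) F" "\<exists>L. (v \<longlongrightarrow> L) F" for F
    using that tendsto_cong[of ?w u F] tendsto_cong[of ?w v F] by blast
  have "isCont ?w s" if "s \<notin> D \<union> E \<union> {r}" for s
    using agree[OF eventually_one_side(3)] that cu[of s] cv[of s]
      isCont_cong[of ?w u s] isCont_cong[of ?w v s] by auto
  moreover have "(\<exists>L. (?w \<longlongrightarrow> L) (at_left s)) \<and> (\<exists>R. (?w \<longlongrightarrow> R) (at_right s))" for s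
    using limit[OF agree[OF eventually_one_side(1)]] limit[OF agree[OF eventually_one_side(2)]]
      lu[of s] lv[of s] by blast
  ultimately show ?thesis
    using \<open>finite D\<close> \<open>finite E\<close> unfolding piecewise_continuous_def
    by (intro exI[of _ "D \<union> E \<union> {r}"]) auto
qed

section \<open>Steering\<close>

definition steerable :: "(real \<Rightarrow> real^'n^'n) \<Rightarrow> real^'n \<Rightarrow> real \<Rightarrow> real \<Rightarrow> real^'n \<Rightarrow> real^'n \<Rightarrow> bool"
  where "steerable A B a b x0 x1 \<longleftrightarrow>
    (\<exists>u x. piecewise_continuous u \<and> solves_lti A B a b u x \<and> x a = x0 \<and> x b = x1)"

lemma steerable_lincomb:
  assumes "steerable A B a b x0 x1" "steerable A B a b y0 y1"
  shows "steerable A B a b (x0 + c *\<^sub>R y0) (x1 + c *\<^sub>R y1)"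
proof -
  obtain u x where "piecewise_continuous u" "solves_lti A B a b u x" "x a = x0" "x b = x1"
    using assms(1) unfolding steerable_def by blast
  moreover obtain v y where "piecewise_continuous v" "solves_lti A B a b v y" "y a = y0" "y b = y1"
    using assms(2) unfolding steerable_def by blast
  ultimately show ?thesis
    unfolding steerable_def
    by (intro exI[of _ "\<lambda>t. u t + c * v t"] exI[of _ "\<lambda>t. x t + c *\<^sub>R y t"] conjI
        piecewise_continuous_lincomb solves_lti_lincomb) simp_all
qed

lemma steerable_0: "steerable A B a b 0 0"
  unfolding steerable_def
  by (intro exI[of _ "\<lambda>_. 0"] conjI piecewise_continuous_const solves_lti_everywhere) auto

lemma subspace_steerable_from_0: "subspace {x1. steerable A B a b 0 x1}"
proof -
  have lincomb: "steerable A B a b 0 (x + c *\<^sub>R y)"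
    if "steerable A B a b 0 x" "steerable A B a b 0 y" for x y c
    using steerable_lincomb[OF that] by simp
  show ?thesis
    unfolding subspace_def mem_Collect_eq
    using lincomb[of _ _ 1] lincomb[OF steerable_0] steerable_0 by auto
qed

lemma steerable_cong:
  assumes "steerable A B a b x0 x1" "\<And>t. t \<in> {a<..<b} \<Longrightarrow> A t = A' t"
  shows "steerable A' B a b x0 x1"
proof -
  obtain u x where "piecewise_continuous u" "solves_lti A B a b u x" "x a = x0" "x b = x1"
    using assms(1) unfolding steerable_def by blast
  moreover have "solves_lti A' B a b u x"
    using \<open>solves_lti A B a b u x\<close> by (rule solves_lti_cong) (simp_all add: assms(2))
  ultimately show ?thesis
    unfolding steerable_def by blast
qed

lemma steerable_trans:
  assumes "a \<le> b" "b \<le> c" "steerable A B a b x0 x1" "steerable A B b c x1 x2"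
  shows "steerable A B a c x0 x2"
proof -
  obtain u1 y1 where u1: "piecewise_continuous u1" and y1: "solves_lti A B a b u1 y1"
    and "y1 a = x0" "y1 b = x1"
    using assms(3) unfolding steerable_def by blast
  obtain u2 y2 where u2: "piecewise_continuous u2" and y2: "solves_lti A B b c u2 y2"
    and "y2 b = x1" "y2 c = x2"
    using assms(4) unfolding steerable_def by blast
  let ?u = "\<lambda>t. if t \<le> b then u1 t else u2 t"
  let ?y = "\<lambda>t. if t \<le> b then y1 t else y2 t"
  have "solves_lti A B a b ?u ?y"
    by (rule solves_lti_cong[OF y1]) auto
  moreover have "solves_lti A B b c ?u ?y"
    by (rule solves_lti_cong[OF y2]) (use \<open>y1 b = x1\<close> \<open>y2 b = x1\<close> in auto)
  ultimately have "solves_lti A B a c ?u ?y"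
    by (rule solves_lti_append[OF assms(1,2)])
  moreover have "?y a = x0" "?y c = x2"
    using assms(1,2) \<open>y1 a = x0\<close> \<open>y1 b = x1\<close> \<open>y2 b = x1\<close> \<open>y2 c = x2\<close> by auto
  ultimately show ?thesis
    unfolding steerable_def using piecewise_continuous_if_le[OF u1 u2] by blast
qed

lemma steerable_free_motion:
  "steerable (\<lambda>_. M) B a b x0 (affine_flow ((*v) M) 0 x0 (b - a))"
  unfolding steerable_def
  by (intro exI[of _ "\<lambda>_. 0"] exI[of _ "\<lambda>t. affine_flow ((*v) M) 0 x0 (t - a)"] conjI
      piecewise_continuous_const) (use solves_lti_affine_flow[of M B a b 0 x0 a] in simp_all)

lemma steerable_step_response:
  assumes "a \<le> r" "r \<le> b"
  shows "steerable (\<lambda>_. M) B a b 0 (affine_flow ((*v) M) B 0 (b - r))"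
proof -
  let ?u = "\<lambda>t. if t \<le> r then 0 else 1"
  let ?x = "\<lambda>t. if t \<le> r then 0 else affine_flow ((*v) M) B 0 (t - r)"
  have "solves_lti (\<lambda>_. M) B a r ?u ?x"
    by (rule solves_lti_cong[OF solves_lti_everywhere[of "\<lambda>_. 0" "\<lambda>_. M" "\<lambda>_. 0"]]) auto
  moreover have "solves_lti (\<lambda>_. M) B r b ?u ?x"
    by (rule solves_lti_cong[OF solves_lti_affine_flow[of M B r b 1 0 r]]) auto
  ultimately have "solves_lti (\<lambda>_. M) B a b ?u ?x"
    by (rule solves_lti_append[OF assms])
  moreover have "piecewise_continuous ?u"
    by (intro piecewise_continuous_if_le piecewise_continuous_const)
  ultimately show ?thesis
    unfolding steerable_def using assms by (intro exI[of _ ?u] exI[of _ ?x]) auto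
qed

lemma completely_herdable_if_steerable_to_positive:
  fixes A :: "real \<Rightarrow> real^'n^'n"
  assumes free: "\<And>x0. \<exists>x1. steerable A B a b x0 x1"
    and pos: "steerable A B a b 0 y" "\<And>j. y $ j > 0"
  shows "completely_herdable A B a b"
  unfolding completely_herdable_def
proof (intro allI impI)
  fix x0 :: "real^'n" and h :: real
  obtain z where z: "steerable A B a b x0 z"
    using free by blast
  define scale where "scale = (\<Sum>j\<in>UNIV. (\<bar>h\<bar> + \<bar>z $ j\<bar>) / y $ j)"
  have bound: "\<bar>h\<bar> + \<bar>z $ j\<bar> \<le> scale * y $ j" for j
  proof -
    have "(\<bar>h\<bar> + \<bar>z $ j\<bar>) / y $ j \<le> scale"
      unfolding scale_def by (rule member_le_sum) (simp_all add: less_imp_le[OF pos(2)])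
    then show ?thesis
      using pos(2)[of j] by (simp add: divide_le_eq)
  qed
  have "h \<le> (z + scale *\<^sub>R y) $ j" for j
    using bound[of j] abs_ge_self[of h] abs_ge_minus_self[of "z $ j"] by simp
  moreover obtain u x where "piecewise_continuous u" "solves_lti A B a b u x" "x a = x0"
    and "x b = z + scale *\<^sub>R y"
    using steerable_lincomb[OF z pos(1), of scale] unfolding steerable_def by auto
  ultimately show "\<exists>u x. piecewise_continuous_on a b u \<and> solves_lti A B a b u x \<and> x a = x0 \<and>
      (\<forall>j. h \<le> x b $ j)"
    using piecewise_continuous_imp_on by metis
qed

section \<open>Krylov spaces\<close>

definition krylov_space :: "real^'n^'n \<Rightarrow> real^'n \<Rightarrow> (real^'n) set" where
  "krylov_space M b = span (range (\<lambda>k. ((*v) M ^^ k) b))"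

lemma bounded_linear_funpow:
  fixes f :: "'a::real_normed_vector \<Rightarrow> 'a"
  shows "bounded_linear f \<Longrightarrow> bounded_linear (f ^^ k)"
  by (induction k) (simp_all add: id_def comp_def bounded_linear_ident bounded_linear_compose)

lemma in_span_if_orthogonal_complement:
  fixes x :: "'a::euclidean_space"
  assumes "\<And>z. (\<And>y. y \<in> S \<Longrightarrow> orthogonal z y) \<Longrightarrow> orthogonal z x"
  shows "x \<in> span S"
proof -
  obtain y z where "y \<in> span S" and z: "\<And>w. w \<in> span S \<Longrightarrow> orthogonal z w" and "x = y + z"
    using orthogonal_subspace_decomp_exists[of S x] by blast
  have "orthogonal z x"
    by (rule assms) (simp add: z span_base)
  moreover have "orthogonal z y"
    by (rule z[OF \<open>y \<in> span S\<close>])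
  ultimately have "z \<bullet> z = 0"
    using \<open>x = y + z\<close> by (simp add: orthogonal_def inner_add_right)
  then show ?thesis
    using \<open>x = y + z\<close> \<open>y \<in> span S\<close> by simp
qed

lemma DERIV_vanishes_if_vanishes_on_interval:
  fixes f f' :: "real \<Rightarrow> real"
  assumes "a < b" "\<And>t. (f has_real_derivative f' t) (at t)" "continuous_on {a..b} f'"
    and "\<And>t. t \<in> {a..b} \<Longrightarrow> f t = 0" "t \<in> {a..b}"
  shows "f' t = 0"
proof (rule continuous_constant_on_closure[where S = "{a<..<b}" and f = f'])
  show "continuous_on (closure {a<..<b}) f'" "t \<in> closure {a<..<b}"
    using assms(1,3,5) by simp_all
  show "f' s = 0" if "s \<in> {a<..<b}" for s
  proof -
    have "(f has_real_derivative 0) (at s)"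
      by (rule has_field_derivative_transform_within_open[OF DERIV_const, of "{a<..<b}"])
        (use that assms(4) in auto)
    then show ?thesis
      using DERIV_unique[OF assms(2)[of s]] by simp
  qed
qed

text \<open>The derivatives of the step response at \<open>0\<close> are the Krylov vectors, so a functional
  vanishing on the step response over a time interval annihilates all of them.\<close>
lemma orthogonal_krylov_if_orthogonal_step_response:
  fixes M :: "real^'n^'n"
  assumes "\<tau> > 0" and orth: "\<And>s. s \<in> {0..\<tau>} \<Longrightarrow> orthogonal z (affine_flow ((*v) M) b 0 s)"
  shows "orthogonal z (((*v) M ^^ k) b)"
proof -
  let ?W = "affine_flow ((*v) M) b 0"
  define h where "h k t = z \<bullet> ((*v) M ^^ k) (?W t)" for k t
  define c where "c k = z \<bullet> ((*v) M ^^ k) b" for k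
  have lin_power: "bounded_linear ((*v) M ^^ k)" for k
    by (intro bounded_linear_funpow matrix_vector_mul_bounded_linear)
  then have lin: "bounded_linear (\<lambda>y. z \<bullet> ((*v) M ^^ k) y)" for k
    by (rule bounded_linear_compose[OF bounded_linear_inner_right])
  have h_deriv: "(h k has_real_derivative h (Suc k) t + c k) (at t)" for k t
  proof -
    have "((\<lambda>t. z \<bullet> ((*v) M ^^ k) (?W t)) has_vector_derivative
        z \<bullet> ((*v) M ^^ k) (M *v ?W t + b)) (at t)"
      by (rule bounded_linear.has_vector_derivative[OF lin
            has_vector_derivative_affine_flow[OF matrix_vector_mul_bounded_linear]])
    then show ?thesis
      by (simp add: has_real_derivative_iff_has_vector_derivative h_def[abs_def] c_def
          linear_add[OF bounded_linear.linear[OF lin_power]] inner_add_right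
          funpow_Suc_right del: funpow.simps)
  qed
  have h_at_0: "h k 0 = 0" for k
    using linear_0[OF bounded_linear.linear[OF lin_power]] by (simp add: h_def)
  have h_cont: "continuous_on {0..\<tau>} (\<lambda>t. h (Suc k) t + c k)" for k
    by (intro continuous_at_imp_continuous_on ballI isCont_add continuous_const
        DERIV_isCont[OF h_deriv])
  have step: "h (Suc k) t + c k = 0" if "\<forall>t\<in>{0..\<tau>}. h k t = 0" "t \<in> {0..\<tau>}" for k t
    by (rule DERIV_vanishes_if_vanishes_on_interval[OF \<open>\<tau> > 0\<close> h_deriv h_cont])
      (use that in auto)
  have "\<forall>t\<in>{0..\<tau>}. h k t = 0" for k
  proof (induction k)
    case 0
    then show ?case
      using orth by (simp add: h_def orthogonal_def)
  next
    case (Suc k)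
    have "c k = 0"
      using step[OF Suc, of 0] h_at_0 \<open>\<tau> > 0\<close> by simp
    then show ?case
      using step[OF Suc] by simp
  qed
  then have "c k = 0"
    using step[of k 0] h_at_0[of "Suc k"] \<open>\<tau> > 0\<close> by simp
  then show ?thesis
    by (simp add: c_def orthogonal_def)
qed

lemma krylov_space_subset_span_step_response:
  fixes M :: "real^'n^'n"
  assumes "\<tau> > 0"
  shows "krylov_space M b \<subseteq> span (affine_flow ((*v) M) b 0 ` {0..\<tau>})"
  unfolding krylov_space_def
proof (rule span_minimal[OF _ subspace_span], clarify)
  fix k
  show "((*v) M ^^ k) b \<in> span (affine_flow ((*v) M) b 0 ` {0..\<tau>})"
    by (rule in_span_if_orthogonal_complement)
      (auto intro: orthogonal_krylov_if_orthogonal_step_response[OF assms])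
qed

lemma steerable_krylov_space:
  assumes "a < b" "x \<in> krylov_space M B"
  shows "steerable (\<lambda>_. M) B a b 0 x"
proof -
  have "affine_flow ((*v) M) B 0 s \<in> {x. steerable (\<lambda>_. M) B a b 0 x}" if "s \<in> {0..b - a}" for s
    using steerable_step_response[of a "b - s" b M B] that by simp
  then have "span (affine_flow ((*v) M) B 0 ` {0..b - a}) \<subseteq> {x. steerable (\<lambda>_. M) B a b 0 x}"
    by (intro span_minimal subspace_steerable_from_0) blast
  then show ?thesis
    using krylov_space_subset_span_step_response[of "b - a" M B] assms by auto
qed

lemma completely_herdable_two_snapshots:
  fixes A1 A2 :: "real^'n^'n"
  assumes "t0 < t1" "t1 < t2"
    and "x \<in> krylov_space A1 B" "w \<in> krylov_space A2 B"
    and pos: "\<And>j. (affine_flow ((*v) A2) 0 x (t2 - t1) + w) $ j > 0"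
  shows "completely_herdable (two_snapshots A1 A2 t1) B t0 t2"
proof (rule completely_herdable_if_steerable_to_positive)
  let ?A = "two_snapshots A1 A2 t1"
  have first: "steerable ?A B t0 t1 x0 x1" if "steerable (\<lambda>_. A1) B t0 t1 x0 x1" for x0 x1
    using that by (rule steerable_cong) (simp add: two_snapshots_def)
  have second: "steerable ?A B t1 t2 x0 x1" if "steerable (\<lambda>_. A2) B t1 t2 x0 x1" for x0 x1
    using that by (rule steerable_cong) (simp add: two_snapshots_def)
  have "steerable ?A B t0 t2 x0
      (affine_flow ((*v) A2) 0 (affine_flow ((*v) A1) 0 x0 (t1 - t0)) (t2 - t1))" for x0
    using assms(1,2) first[OF steerable_free_motion] second[OF steerable_free_motion]
    by (blast intro: steerable_trans less_imp_le)
  then show "\<exists>x1. steerable ?A B t0 t2 x0 x1" for x0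
    by blast
  have "steerable (\<lambda>_. A2) B t1 t2 (x + 1 *\<^sub>R 0) (affine_flow ((*v) A2) 0 x (t2 - t1) + 1 *\<^sub>R w)"
    using assms(2,4) by (intro steerable_lincomb steerable_free_motion steerable_krylov_space)
  then have "steerable ?A B t1 t2 x (affine_flow ((*v) A2) 0 x (t2 - t1) + w)"
    by (intro second) simp
  moreover have "steerable ?A B t0 t1 0 x"
    using assms(1,3) by (intro first steerable_krylov_space)
  ultimately show "steerable ?A B t0 t2 0 (affine_flow ((*v) A2) 0 x (t2 - t1) + w)"
    using assms(1,2) by (blast intro: steerable_trans less_imp_le)
qed (fact pos)

lemma exists_completely_herdable_two_snapshots:
  fixes A1 A2 :: "real^'n^'n"
  assumes "v \<in> krylov_space A1 B" "w \<in> krylov_space A2 B" "\<And>j. v $ j < w $ j"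
  shows "\<exists>t2>1. completely_herdable (two_snapshots A1 A2 1) B 0 t2"
proof -
  let ?y = "\<lambda>\<tau>. affine_flow ((*v) A2) 0 (- v) \<tau> + w"
  have "isCont (affine_flow ((*v) A2) 0 (- v)) 0"
    by (rule has_vector_derivative_continuous[OF has_vector_derivative_affine_flow])
      (rule matrix_vector_mul_bounded_linear)
  then have "(?y \<longlongrightarrow> - v + w) (at_right 0)"
    by (intro tendsto_add tendsto_const) (simp add: isCont_def filterlim_at_split)
  then have "((\<lambda>\<tau>. ?y \<tau> $ j) \<longlongrightarrow> (- v + w) $ j) (at_right 0)" for j
    by (rule tendsto_vec_nth)
  then have "\<forall>\<^sub>F \<tau> in at_right 0. ?y \<tau> $ j > 0" for j
    by (rule order_tendstoD(1)) (use assms(3)[of j] in simp)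
  then have "\<forall>\<^sub>F \<tau> in at_right 0. \<tau> > 0 \<and> (\<forall>j. ?y \<tau> $ j > 0)"
    using eventually_at_right_less by (intro eventually_conj eventually_all_finite) auto
  then obtain \<tau> :: real where "\<tau> > 0" "\<And>j. ?y \<tau> $ j > 0"
    using eventually_happens'[OF trivial_limit_at_right_real] by blast
  moreover have "- v \<in> krylov_space A1 B"
    using assms(1) by (simp add: krylov_space_def span_neg)
  ultimately have "completely_herdable (two_snapshots A1 A2 1) B 0 (1 + \<tau>)"
    by (intro completely_herdable_two_snapshots[OF _ _ _ assms(2)]) auto
  then show ?thesis
    using \<open>\<tau> > 0\<close> by (intro exI[of _ "1 + \<tau>"]) auto
qed

section \<open>Choosing the two realizations\<close>

lemma subspace_has_nowhere_zero_vector: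
  fixes V :: "(real^'n) set"
  assumes "subspace V" and nonzero: "\<And>j. \<exists>v\<in>V. v $ j \<noteq> 0"
  shows "\<exists>v\<in>V. \<forall>j. v $ j \<noteq> 0"
proof -
  have "\<exists>v\<in>V. \<forall>j\<in>J. v $ j \<noteq> 0" if "finite J" for J
    using that
  proof (induction J rule: finite_induct)
    case empty
    then show ?case
      using subspace_0[OF assms(1)] by blast
  next
    case (insert i J)
    obtain v where "v \<in> V" and v: "\<forall>j\<in>J. v $ j \<noteq> 0"
      using insert.IH by blast
    obtain u where "u \<in> V" "u $ i \<noteq> 0"
      using nonzero by blast
    have "finite (range (\<lambda>j. - v $ j / u $ j))"
      by simp
    then obtain c :: real where c: "c \<notin> range (\<lambda>j. - v $ j / u $ j)"
      using ex_new_if_finite[OF infinite_UNIV_char_0] by blast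
    have "(v + c *\<^sub>R u) $ j \<noteq> 0" if "j \<in> insert i J" for j
    proof (cases "u $ j = 0")
      case True
      then show ?thesis
        using that v \<open>u $ i \<noteq> 0\<close> by auto
    next
      case False
      have "c \<noteq> - v $ j / u $ j"
        using c by auto
      then show ?thesis
        using False by (simp add: field_simps)
    qed
    moreover have "v + c *\<^sub>R u \<in> V"
      using assms(1) \<open>v \<in> V\<close> \<open>u \<in> V\<close> by (simp add: subspace_add subspace_scale)
    ultimately show ?case
      by blast
  qed
  from this[of UNIV] show ?thesis
    by simp
qed

lemma krylov_space_scaleR_subset: "krylov_space M (c *\<^sub>R b) \<subseteq> krylov_space M b"
  unfolding krylov_space_def
proof (rule span_minimal[OF _ subspace_span], clarify)
  fix k
  have "((*v) M ^^ k) (c *\<^sub>R b) = c *\<^sub>R ((*v) M ^^ k) b"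
    by (rule linear_scale[OF bounded_linear.linear[OF bounded_linear_funpow]])
      (rule matrix_vector_mul_bounded_linear)
  then show "((*v) M ^^ k) (c *\<^sub>R b) \<in> span (range (\<lambda>k. ((*v) M ^^ k) b))"
    by (simp add: span_base span_scale)
qed

definition diag_scale :: "('n \<Rightarrow> real) \<Rightarrow> real^'n \<Rightarrow> real^'n" where
  "diag_scale d x = (\<chi> j. d j * x $ j)"

definition diag_conj :: "('n \<Rightarrow> real) \<Rightarrow> real^'n^'n \<Rightarrow> real^'n^'n" where
  "diag_conj d M = (\<chi> j m. d j * M $ j $ m / d m)"

lemma linear_diag_scale: "linear (diag_scale d)"
  by (rule linearI) (simp_all add: diag_scale_def vec_eq_iff algebra_simps)

lemma diag_conj_mult_diag_scale:
  assumes "\<And>j. d j \<noteq> 0"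
  shows "diag_conj d M *v diag_scale d x = diag_scale d (M *v x)"
  using assms
  by (simp add: vec_eq_iff diag_conj_def diag_scale_def matrix_vector_mult_def sum_distrib_left
      mult_ac)

lemma has_sign_pattern_diag_conj:
  assumes "\<And>j. d j > 0" "has_sign_pattern S M"
  shows "has_sign_pattern S (diag_conj d M)"
  using assms unfolding has_sign_pattern_def diag_conj_def
  by (auto simp: divide_pos_pos mult_pos_neg divide_neg_pos)

lemma diag_scale_krylov_space:
  assumes "\<And>j. d j \<noteq> 0" "v \<in> krylov_space M b"
  shows "diag_scale d v \<in> krylov_space (diag_conj d M) (diag_scale d b)"
proof -
  have "((*v) (diag_conj d M) ^^ k) (diag_scale d b) = diag_scale d (((*v) M ^^ k) b)" for k
    by (induction k) (simp_all add: diag_conj_mult_diag_scale[OF assms(1)])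
  then have "diag_scale d ` krylov_space M b = krylov_space (diag_conj d M) (diag_scale d b)"
    unfolding krylov_space_def span_linear_image[OF linear_diag_scale, symmetric]
    by (simp add: image_image)
  then show ?thesis
    using assms(2) by blast
qed

lemma exists_conjugate_realization_above:
  fixes A1 :: "real^'n^'n"
  assumes "has_sign_pattern S A1" "v \<in> krylov_space A1 B" "\<And>j. v $ j \<noteq> 0"
    and "\<And>j. j \<noteq> l \<Longrightarrow> B $ j = 0"
  shows "\<exists>A2. has_sign_pattern S A2 \<and> (\<exists>w\<in>krylov_space A2 B. \<forall>j. v $ j < w $ j)"
proof -
  define d :: "'n \<Rightarrow> real" where "d j = (if v $ j > 0 then 2 else 1 / 2)" for j
  have d_pos: "d j > 0" for j
    by (simp add: d_def)
  then have "d j \<noteq> 0" for j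
    by (metis less_irrefl)
  then have "diag_scale d v \<in> krylov_space (diag_conj d A1) (diag_scale d B)"
    using assms(2) by (rule diag_scale_krylov_space)
  also have "diag_scale d B = d l *\<^sub>R B"
  proof -
    have "diag_scale d B $ j = (d l *\<^sub>R B) $ j" for j
      using assms(4)[of j] by (cases "j = l") (simp_all add: diag_scale_def)
    then show ?thesis
      by (simp add: vec_eq_iff)
  qed
  finally have "diag_scale d v \<in> krylov_space (diag_conj d A1) B"
    using krylov_space_scaleR_subset by blast
  moreover have "v $ j < diag_scale d v $ j" for j
    using assms(3)[of j] by (auto simp: d_def diag_scale_def)
  moreover have "has_sign_pattern S (diag_conj d A1)"
    using d_pos assms(1) by (rule has_sign_pattern_diag_conj)
  ultimately show ?thesis
    by blast
qed

definition depth :: "('n \<Rightarrow> 'n \<Rightarrow> sign) \<Rightarrow> 'n \<Rightarrow> 'n \<Rightarrow> nat" where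
  "depth S l j = (LEAST k. (edge S ^^ k) l j)"

definition parent :: "('n \<Rightarrow> 'n \<Rightarrow> sign) \<Rightarrow> 'n \<Rightarrow> 'n \<Rightarrow> 'n" where
  "parent S l j = (SOME p. (edge S ^^ (depth S l j - 1)) l p \<and> edge S p j)"

lemma walk_depth: "(edge S)\<^sup>*\<^sup>* l j \<Longrightarrow> (edge S ^^ depth S l j) l j"
  unfolding depth_def rtranclp_power by (rule LeastI_ex)

lemma depth_le: "(edge S ^^ k) l j \<Longrightarrow> depth S l j \<le> k"
  unfolding depth_def by (rule Least_le)

lemma depth_root: "depth S l l = 0"
  using depth_le[of 0 S l l] by simp

lemma depth_parent:
  assumes "(edge S)\<^sup>*\<^sup>* l j" "j \<noteq> l"
  shows "edge S (parent S l j) j" "depth S l j = Suc (depth S l (parent S l j))"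
proof -
  obtain k where k: "depth S l j = Suc k"
    using walk_depth[OF assms(1)] assms(2) by (cases "depth S l j") auto
  then have "\<exists>p. (edge S ^^ k) l p \<and> edge S p j"
    using walk_depth[OF assms(1)] by auto
  then have p: "(edge S ^^ k) l (parent S l j) \<and> edge S (parent S l j) j"
    unfolding parent_def k by (simp, rule someI_ex)
  then show "edge S (parent S l j) j"
    by blast
  have "(edge S ^^ Suc (depth S l (parent S l j))) l j"
    using p walk_depth[OF relpowp_imp_rtranclp] by (meson relpowp_Suc_I)
  then have "k \<le> depth S l (parent S l j)"
    using depth_le k by fastforce
  moreover have "depth S l (parent S l j) \<le> k"
    using p depth_le[where k = k and j = "parent S l j"] by blast
  ultimately show "depth S l j = Suc (depth S l (parent S l j))"
    using k by simp
qed

fun sign_value :: "sign \<Rightarrow> real" where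
  "sign_value Plus = 1"
| "sign_value Minus = -1"
| "sign_value Zero = 0"

text \<open>Every edge gets weight \<open>\<epsilon>\<close> except the edge from the parent in a shortest-path tree
  rooted at the leader, which gets weight \<open>1\<close>. For \<open>\<epsilon> = 0\<close> only the tree is left, so the
  Krylov vector of each node's depth cannot suffer from cancellations at that node.\<close>
definition tree_realization :: "('n::finite \<Rightarrow> 'n \<Rightarrow> sign) \<Rightarrow> 'n \<Rightarrow> real \<Rightarrow> real^'n^'n" where
  "tree_realization S l \<epsilon> =
     (\<chi> j m. (if j \<noteq> l \<and> m = parent S l j then 1 else \<epsilon>) * sign_value (S j m))"

lemma has_sign_pattern_tree_realization:
  "\<epsilon> > 0 \<Longrightarrow> has_sign_pattern S (tree_realization S l \<epsilon>)"
  unfolding has_sign_pattern_def tree_realization_def by auto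

lemma tree_realization_0_krylov_nonzero:
  assumes reach: "\<forall>j. (edge S)\<^sup>*\<^sup>* l j" and "b1 \<noteq> 0" and "depth S l j = k"
  shows "((*v) (tree_realization S l 0) ^^ k) (\<chi> i. if i = l then b1 else 0) $ j \<noteq> 0"
  using assms(3)
proof (induction k arbitrary: j)
  case 0
  then have "j = l"
    using depth_parent(2) reach by fastforce
  then show ?case
    using \<open>b1 \<noteq> 0\<close> by simp
next
  case (Suc k)
  let ?p = "parent S l j"
  let ?y = "((*v) (tree_realization S l 0) ^^ k) (\<chi> i. if i = l then b1 else 0)"
  have "j \<noteq> l"
    using Suc.prems depth_root[of S l] by auto
  then have "edge S ?p j" "depth S l ?p = k"
    using depth_parent[OF reach[rule_format]] Suc.prems by auto
  have "((*v) (tree_realization S l 0) ^^ Suc k) (\<chi> i. if i = l then b1 else 0) $ j =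
      (\<Sum>m\<in>UNIV. tree_realization S l 0 $ j $ m * ?y $ m)"
    by (simp add: matrix_vector_mult_def)
  also have "\<dots> = (\<Sum>m\<in>UNIV. if m = ?p then sign_value (S j m) * ?y $ m else 0)"
    by (rule sum.cong) (auto simp: tree_realization_def \<open>j \<noteq> l\<close>)
  also have "\<dots> = sign_value (S j ?p) * ?y $ ?p"
    by simp
  finally show ?case
    using Suc.IH[OF \<open>depth S l ?p = k\<close>] \<open>edge S ?p j\<close>
    by (cases "S j ?p") (auto simp: edge_def)
qed

lemma isCont_tree_realization_power:
  "isCont (\<lambda>\<epsilon>. ((*v) (tree_realization S l \<epsilon>) ^^ k) y $ j) \<epsilon>0"
proof (induction k arbitrary: j)
  case (Suc k)
  have entry: "isCont (\<lambda>\<epsilon>. tree_realization S l \<epsilon> $ j $ m) \<epsilon>0" for m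
    unfolding tree_realization_def
    by (cases "j \<noteq> l \<and> m = parent S l j") (auto intro!: continuous_intros)
  have component: "(M *v x) $ j = (\<Sum>m\<in>UNIV. M $ j $ m * x $ m)" for M :: "real^'a^'a" and x
    by (simp add: matrix_vector_mult_def)
  show ?case
    unfolding funpow.simps(2) comp_apply component by (intro continuous_intros entry Suc.IH)
qed simp

lemma exists_realization_krylov_nowhere_zero:
  fixes S :: "'n::finite \<Rightarrow> 'n \<Rightarrow> sign"
  assumes "\<forall>j. (edge S)\<^sup>*\<^sup>* l j" "b1 \<noteq> 0"
  shows "\<exists>A. has_sign_pattern S A \<and>
    (\<exists>v\<in>krylov_space A (\<chi> i. if i = l then b1 else 0). \<forall>j. v $ j \<noteq> 0)"
proof -
  let ?B = "\<chi> i. if i = l then b1 else 0"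
  let ?x = "\<lambda>\<epsilon> j. ((*v) (tree_realization S l \<epsilon>) ^^ depth S l j) ?B $ j"
  have "\<forall>\<^sub>F \<epsilon> in at_right 0. ?x \<epsilon> j \<noteq> 0" for j
  proof (rule tendsto_imp_eventually_ne)
    show "((\<lambda>\<epsilon>. ?x \<epsilon> j) \<longlongrightarrow> ?x 0 j) (at_right 0)"
      using isCont_tree_realization_power unfolding isCont_def
      by (rule filterlim_at_split[THEN iffD1, THEN conjunct2])
    show "?x 0 j \<noteq> 0"
      using tree_realization_0_krylov_nonzero[OF assms] by blast
  qed
  then have "\<forall>\<^sub>F \<epsilon> in at_right 0. \<epsilon> > 0 \<and> (\<forall>j. ?x \<epsilon> j \<noteq> 0)"
    using eventually_at_right_less by (intro eventually_conj eventually_all_finite) auto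
  then obtain \<epsilon> :: real where "\<epsilon> > 0" and nonzero: "\<And>j. ?x \<epsilon> j \<noteq> 0"
    using eventually_happens'[OF trivial_limit_at_right_real] by blast
  have "\<exists>v\<in>krylov_space (tree_realization S l \<epsilon>) ?B. v $ j \<noteq> 0" for j
    using nonzero[of j] unfolding krylov_space_def by (blast intro: span_base)
  then have "\<exists>v\<in>krylov_space (tree_realization S l \<epsilon>) ?B. \<forall>j. v $ j \<noteq> 0"
    by (intro subspace_has_nowhere_zero_vector) (simp_all add: krylov_space_def subspace_span)
  then show ?thesis
    using has_sign_pattern_tree_realization[OF \<open>\<epsilon> > 0\<close>] by blast
qed

section \<open>Herdability within two snapshots\<close>

theorem mainTheorem4:
  fixes S :: "'n::finite \<Rightarrow> 'n \<Rightarrow> sign" and l :: 'n and b1 :: real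
  assumes b1_pos: "b1 > 0"
    and leader_no_in: "\<forall>k. k \<noteq> l \<longrightarrow> S l k = Zero"
    and reach: "\<forall>j. (edge S)\<^sup>*\<^sup>* l j"
  shows "\<exists>A1 A2 t0 t1 t2. has_sign_pattern S A1 \<and> has_sign_pattern S A2 \<and> t0 < t1 \<and> t1 < t2 \<and>
           completely_herdable (two_snapshots A1 A2 t1)
             (\<chi> j. if j = l then b1 else 0) t0 t2"
proof -
  let ?B = "\<chi> j. if j = l then b1 else 0"
  have "b1 \<noteq> 0"
    using b1_pos by simp
  then obtain A1 v where A1: "has_sign_pattern S A1" and v: "v \<in> krylov_space A1 ?B"
    and nonzero: "\<And>j. v $ j \<noteq> 0"
    using exists_realization_krylov_nowhere_zero[OF reach] by blast
  obtain A2 w where A2: "has_sign_pattern S A2" and w: "w \<in> krylov_space A2 ?B"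
    and above: "\<And>j. v $ j < w $ j"
    using exists_conjugate_realization_above[OF A1 v nonzero, of l] by auto
  obtain t2 where "t2 > 1" and "completely_herdable (two_snapshots A1 A2 1) ?B 0 t2"
    using exists_completely_herdable_two_snapshots[OF v w above] by blast
  then show ?thesis
    using A1 A2 zero_less_one by blast
qed

end
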